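(* Let $\mathcal{G}=(\mathcal{V},\mathcal{E})$ be a finite graph, let $\hat{\bm{y}}\in\mathbb{R}^{\mathcal{V}}$ be a given prediction, and run the adaptive stabilized column generation method (ASCG, described in the context) from any initial set of maximal independent sets and any initial penalty value $\epsilon\ge 0$. Then the penalty value $\epsilon$ reduces to $0$ in a finite number of iterations; that is, there is a finite iteration at which the update rule of the method sets $\epsilon=0$.
   Context: Let $\mathcal{S}$ be the set of all maximal independent sets (MISs) of the finite graph $\mathcal{G}=(\mathcal{V},\mathcal{E})$, each regarded as a subset $s\subseteq\mathcal{V}$. Generalized restricted dual problem G-RDP$(\mathcal{S}',\hat{\bm{y}},\epsilon)$, for $\mathcal{S}'\subseteq\mathcal{S}$, $\hat{\bm{y}}\in\mathbb{R}^{\mathcal{V}}$, $\epsilon\ge 0$: maximize $\sum_{i\in\mathcal{V}}(\pi_i-\epsilon w_i^- -\epsilon w_i^+)$ over $(\bm{\pi},\bm{w}^+,\bm{w}^-)$ subject to $\sum_{i\in s}\pi_i\le 1$ for all $s\in\mathcal{S}'$; $-\pi_i-w_i^-\le-\hat{y}_i$ and $\pi_i-w_i^+\le\hat{y}_i$ for all $i\in\mathcal{V}$; and $0\le\pi_i,w_i^-,w_i^+\le 1$ for all $i\in\mathcal{V}$. The vector $\hat{\bm{y}}$ is such that these problems are feasible (e.g. $\hat{\bm{y}}\in[0,1]^{\mathcal{V}}$). ASCG method: start with an initial $\mathcal{S}'\subseteq\mathcal{S}$ and an initial $\epsilon\ge 0$. In each iteration: (1) let $\bm{\pi}^{\epsilon}$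 be the $\bm{\pi}$-part of an optimal solution of G-RDP$(\mathcal{S}',\hat{\bm{y}},\epsilon)$; (2) (pricing, solved exactly) compute the minimum reduced cost $c^*_{\epsilon}=\min_{s\in\mathcal{S}}\bigl(1-\sum_{i\in s}\pi_i^{\epsilon}\bigr)$ and a minimizer $s^*\in\mathcal{S}$; (3) replace $\mathcal{S}'$ by $\mathcal{S}'\cup\{s^*\}$; (4) update $\epsilon$ to $\dfrac{c^*_{\epsilon}}{c^*_{\epsilon}-1}$ if $c^*_{\epsilon}<0$, and to $0$ if $c^*_{\epsilon}\ge 0$. The iterations are repeated until $c^*_{\epsilon}\ge 0$ and $\epsilon=0$. *)

theory Defs
  imports Complex_Main "HOL-Library.Extended_Nat"
begin

definition finite_graph :: "'a set \<Rightarrow> 'a set set \<Rightarrow> bool" where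
  "finite_graph V E \<longleftrightarrow> finite V \<and> (\<forall>e\<in>E. e \<subseteq> V \<and> card e = 2)"

definition independent_set :: "'a set \<Rightarrow> 'a set set \<Rightarrow> 'a set \<Rightarrow> bool" where
  "independent_set V E s \<longleftrightarrow> s \<subseteq> V \<and> (\<forall>u\<in>s. \<forall>v\<in>s. {u, v} \<notin> E)"

definition MIS :: "'a set \<Rightarrow> 'a set set \<Rightarrow> 'a set set" where
  "MIS V E = {s. independent_set V E s \<and> \<not> (\<exists>t. independent_set V E t \<and> s \<subset> t)}"

text \<open>Vectors indexed by \<open>V\<close> are functions on the vertex type; values outside \<open>V\<close> play no role.
  Points of the linear program are triples \<open>(\<pi>, w\<^sup>+, w\<^sup>-)\<close>.\<close>

type_synonym 'a point = "('a \<Rightarrow> real) \<times> ('a \<Rightarrow> real) \<times> ('a \<Rightarrow> real)"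

definition grdp_feasible :: "'a set \<Rightarrow> 'a set set \<Rightarrow> ('a \<Rightarrow> real) \<Rightarrow> 'a point \<Rightarrow> bool" where
  "grdp_feasible V S y = (\<lambda>(\<pi>, wp, wm).
     (\<forall>s\<in>S. (\<Sum>i\<in>s. \<pi> i) \<le> 1) \<and>
     (\<forall>i\<in>V. - \<pi> i - wm i \<le> - y i \<and> \<pi> i - wp i \<le> y i) \<and>
     (\<forall>i\<in>V. 0 \<le> \<pi> i \<and> \<pi> i \<le> 1 \<and> 0 \<le> wm i \<and> wm i \<le> 1 \<and> 0 \<le> wp i \<and> wp i \<le> 1))"

definition grdp_objective :: "'a set \<Rightarrow> real \<Rightarrow> 'a point \<Rightarrow> real" where
  "grdp_objective V \<epsilon> = (\<lambda>(\<pi>, wp, wm). \<Sum>i\<in>V. \<pi> i - \<epsilon> * wm i - \<epsilon> * wp i)"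

definition grdp_optimal :: "'a set \<Rightarrow> 'a set set \<Rightarrow> ('a \<Rightarrow> real) \<Rightarrow> real \<Rightarrow> 'a point \<Rightarrow> bool" where
  "grdp_optimal V S y \<epsilon> = is_arg_max (grdp_objective V \<epsilon>) (grdp_feasible V S y)"

definition reduced_cost :: "('a \<Rightarrow> real) \<Rightarrow> 'a set \<Rightarrow> real" where
  "reduced_cost \<pi> s = 1 - (\<Sum>i\<in>s. \<pi> i)"

definition min_reduced_cost :: "'a set \<Rightarrow> 'a set set \<Rightarrow> ('a \<Rightarrow> real) \<Rightarrow> real" where
  "min_reduced_cost V E \<pi> = Min (reduced_cost \<pi> ` MIS V E)"

definition update_penalty :: "real \<Rightarrow> real" where
  "update_penalty c = (if c < 0 then c / (c - 1) else 0)"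

text \<open>Admissible choices of \<open>\<pi>\<close> and of the new column \<open>s\<close> in an iteration that starts with
  columns \<open>S\<close> and penalty \<open>\<epsilon>\<close>. Neither choice need be unique.\<close>

definition ascg_choice ::
  "'a set \<Rightarrow> 'a set set \<Rightarrow> ('a \<Rightarrow> real) \<Rightarrow> 'a set set \<Rightarrow> real \<Rightarrow> ('a \<Rightarrow> real) \<Rightarrow> 'a set \<Rightarrow> bool" where
  "ascg_choice V E y S \<epsilon> \<pi> s \<longleftrightarrow>
     (\<exists>wp wm. grdp_optimal V S y \<epsilon> (\<pi>, wp, wm)) \<and>
     s \<in> MIS V E \<and> reduced_cost \<pi> s = min_reduced_cost V E \<pi>"

text \<open>The stopping test concerns the penalty with which \<open>\<pi>\<close> was computed, not the updated one.\<close>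

definition ascg_stop :: "'a set \<Rightarrow> 'a set set \<Rightarrow> real \<Rightarrow> ('a \<Rightarrow> real) \<Rightarrow> bool" where
  "ascg_stop V E \<epsilon> \<pi> \<longleftrightarrow> min_reduced_cost V E \<pi> \<ge> 0 \<and> \<epsilon> = 0"

text \<open>A complete run with \<open>N\<close> iterations, where \<open>N\<close> may be \<open>\<infinity>\<close>. Iteration \<open>k < N\<close> starts with
  columns \<open>S k\<close> and penalty \<open>\<epsilon> k\<close>, chooses \<open>\<pi> k\<close> and \<open>s k\<close>, and produces \<open>S (Suc k)\<close> and
  \<open>\<epsilon> (Suc k)\<close>; the sequences are unconstrained beyond that. A finite run ends because the stopping
  test succeeded or because the next iteration cannot be carried out. The second alternative is
  included so that well-definedness of the iterations is not presupposed.\<close>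

definition ascg_run ::
  "'a set \<Rightarrow> 'a set set \<Rightarrow> ('a \<Rightarrow> real) \<Rightarrow> 'a set set \<Rightarrow> real \<Rightarrow> enat \<Rightarrow>
   (nat \<Rightarrow> 'a set set) \<Rightarrow> (nat \<Rightarrow> real) \<Rightarrow> (nat \<Rightarrow> 'a \<Rightarrow> real) \<Rightarrow> (nat \<Rightarrow> 'a set) \<Rightarrow> bool" where
  "ascg_run V E y S\<^sub>0 \<epsilon>\<^sub>0 N S \<epsilon> \<pi> s \<longleftrightarrow>
     S 0 = S\<^sub>0 \<and> \<epsilon> 0 = \<epsilon>\<^sub>0 \<and>
     (\<forall>k. enat k < N \<longrightarrow>
        ascg_choice V E y (S k) (\<epsilon> k) (\<pi> k) (s k) \<and>
        S (Suc k) = S k \<union> {s k} \<and>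
        \<epsilon> (Suc k) = update_penalty (min_reduced_cost V E (\<pi> k))) \<and>
     (\<forall>k. enat (Suc k) < N \<longrightarrow> \<not> ascg_stop V E (\<epsilon> k) (\<pi> k)) \<and>
     (\<forall>n. N = enat n \<longrightarrow>
        (\<exists>k. n = Suc k \<and> ascg_stop V E (\<epsilon> k) (\<pi> k)) \<or>
        \<not> (\<exists>\<pi>' s'. ascg_choice V E y (S n) (\<epsilon> n) \<pi>' s'))"

end

theory Submission
  imports Defs "HOL-Analysis.Analysis"
begin

text \<open>While the updated penalty stays positive, the minimum reduced cost is negative, so the new
  column violates a constraint that the current \<open>\<pi>\<close> satisfies for every column already present.
  Hence the column set grows strictly inside the finite set of all maximal independent sets and the
  run is finite. By compactness every restricted problem has an optimal solution, so such a
  run can only end by the stopping test, which forces the update to \<open>0\<close>.\<close>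

lemma finite_MIS: "finite_graph V E \<Longrightarrow> finite (MIS V E)"
  by (rule finite_subset[of _ "Pow V"])
    (auto simp: MIS_def independent_set_def finite_graph_def)

text \<open>The empty set is independent and a finite nonempty family has a maximal member. This
  makes the \<open>Min\<close> in the pricing step attained.\<close>

lemma MIS_nonempty:
  assumes "finite_graph V E"
  shows "MIS V E \<noteq> {}"
proof -
  let ?I = "{t. independent_set V E t}"
  have "finite ?I"
    by (rule finite_subset[of _ "Pow V"])
      (use assms in \<open>auto simp: independent_set_def finite_graph_def\<close>)
  moreover have "{} \<in> ?I"
    by (simp add: independent_set_def)
  ultimately obtain m where "m \<in> ?I" "\<And>t. t \<in> ?I \<Longrightarrow> m \<subseteq> t \<Longrightarrow> m = t"
    using finite_has_maximal[of ?I] by blast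
  then show ?thesis
    unfolding MIS_def by blast
qed

lemma MIS_subset: "s \<in> MIS V E \<Longrightarrow> s \<subseteq> V"
  by (simp add: MIS_def independent_set_def)

text \<open>Tychonoff's theorem: functions carry the product topology, and the vertex type may be
  infinite even though \<open>V\<close> is finite.\<close>

lemma compact_unit_box: "compact {f :: 'a \<Rightarrow> real. \<forall>i. 0 \<le> f i \<and> f i \<le> 1}"
proof -
  have "{f :: 'a \<Rightarrow> real. \<forall>i. 0 \<le> f i \<and> f i \<le> 1} = PiE UNIV (\<lambda>_. {0..1})"
    by (auto simp: PiE_def Pi_def)
  moreover have "compactin (product_topology (\<lambda>_::'a. euclideanreal) UNIV) (PiE UNIV (\<lambda>_. {0..1}))"
    by (simp add: compactin_PiE)
  ultimately show ?thesis
    by (simp add: euclidean_product_topology)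
qed

lemma continuous_on_point_coordinates:
  fixes A :: "'a point set"
  shows "continuous_on A (\<lambda>x. fst x i)"
    and "continuous_on A (\<lambda>x. fst (snd x) i)"
    and "continuous_on A (\<lambda>x. snd (snd x) i)"
  by (rule continuous_on_product_then_coordinatewise,
      intro continuous_on_fst continuous_on_snd continuous_on_id)+

lemma closed_grdp_feasible: "closed {x :: 'a point. grdp_feasible V S y x}"
  unfolding grdp_feasible_def split_beta Ball_def
  \<comment> \<open>The premise of each bounded quantifier does not depend on the point, so it is an
    open condition and the implication stays closed.\<close>
  by (intro closed_Collect_conj closed_Collect_all closed_Collect_imp open_Collect_const
      closed_Collect_le continuous_on_add continuous_on_diff continuous_on_minus
      continuous_on_sum continuous_on_const continuous_on_point_coordinates)

lemma continuous_on_grdp_objective: "continuous_on A (grdp_objective V \<epsilon>)"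
  unfolding grdp_objective_def split_beta
  by (intro continuous_on_diff continuous_on_sum continuous_on_mult continuous_on_const
      continuous_on_point_coordinates)

text \<open>A continuous objective attains its maximum on the compact set \<open>?K\<close>. Because
  columns lie inside \<open>V\<close>, the truncation \<open>R\<close> maps any feasible point into
  \<open>?K\<close> without changing its objective value.\<close>

lemma grdp_optimal_exists:
  assumes sub: "\<And>s. s \<in> S \<Longrightarrow> s \<subseteq> V"
    and feas: "\<exists>x. grdp_feasible V S y x"
  shows "\<exists>x. grdp_optimal V S y \<epsilon> x"
proof -
  let ?B = "{f :: 'a \<Rightarrow> real. \<forall>i. 0 \<le> f i \<and> f i \<le> 1}"
  let ?K = "(?B \<times> ?B \<times> ?B) \<inter> {x. grdp_feasible V S y x}"
  \<comment> \<open>Coordinates outside \<open>V\<close> are unconstrained, so the feasible set itself is not compact.\<close>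
  define r :: "('a \<Rightarrow> real) \<Rightarrow> 'a \<Rightarrow> real" where "r f i = (if i \<in> V then f i else 0)" for f i
  define R where "R = map_prod r (map_prod r r)"
  have r_sum: "sum (r f) t = sum f t" if "t \<subseteq> V" for f t
    by (rule sum.cong) (use that in \<open>auto simp: r_def\<close>)
  have R_mem: "R x \<in> ?K" if "grdp_feasible V S y x" for x
  proof -
    obtain p wp wm where x: "x = (p, wp, wm)"
      by (cases x)
    have "grdp_feasible V S y (r p, r wp, r wm)"
      using that by (simp add: x grdp_feasible_def r_sum[OF sub]) (simp add: r_def)
    moreover have "r p \<in> ?B" "r wp \<in> ?B" "r wm \<in> ?B"
      using that by (simp_all add: x grdp_feasible_def r_def)
    ultimately show ?thesis
      by (simp add: x R_def)
  qed
  have R_obj: "grdp_objective V \<epsilon> (R x) = grdp_objective V \<epsilon> x" for x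
    by (cases x) (simp add: R_def grdp_objective_def r_def)
  have "compact ?K"
    by (intro compact_Int_closed compact_Times compact_unit_box closed_grdp_feasible)
  moreover have "?K \<noteq> {}"
    using feas R_mem by blast
  ultimately have "\<exists>x\<in>?K. \<forall>z\<in>?K. grdp_objective V \<epsilon> z \<le> grdp_objective V \<epsilon> x"
    by (rule continuous_attains_sup[OF _ _ continuous_on_grdp_objective])
  then obtain x where x: "x \<in> ?K"
    and max: "\<And>z. z \<in> ?K \<Longrightarrow> grdp_objective V \<epsilon> z \<le> grdp_objective V \<epsilon> x"
    by (elim bexE) (rule that, assumption, erule bspec)
  have "grdp_objective V \<epsilon> z \<le> grdp_objective V \<epsilon> x" if "grdp_feasible V S y z" for z
    using max[OF R_mem[OF that]] by (simp add: R_obj)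
  then have "grdp_optimal V S y \<epsilon> x"
    using x by (simp add: grdp_optimal_def is_arg_max_linorder)
  then show ?thesis ..
qed

text \<open>Rules out that a run gets stuck: an optimal solution exists by compactness, and a
  minimum over finitely many columns is attained.\<close>

lemma ascg_choice_exists:
  assumes "finite_graph V E" "S \<subseteq> MIS V E" "\<exists>x. grdp_feasible V S y x"
  shows "\<exists>\<pi> s. ascg_choice V E y S \<epsilon> \<pi> s"
proof -
  have "\<And>s. s \<in> S \<Longrightarrow> s \<subseteq> V"
    using assms(2) MIS_subset by blast
  from grdp_optimal_exists[OF this assms(3)]
  obtain \<pi> wp wm where "grdp_optimal V S y \<epsilon> (\<pi>, wp, wm)"
    by (metis prod_cases3)
  moreover have "min_reduced_cost V E \<pi> \<in> reduced_cost \<pi> ` MIS V E"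
    unfolding min_reduced_cost_def
    using finite_MIS[OF assms(1)] MIS_nonempty[OF assms(1)] by (intro Min_in) auto
  then obtain s where "s \<in> MIS V E" "reduced_cost \<pi> s = min_reduced_cost V E \<pi>"
    by auto
  ultimately show ?thesis
    unfolding ascg_choice_def by blast
qed

text \<open>Feasibility of \<open>\<pi>\<close> gives every column of \<open>S\<close> a nonnegative
  reduced cost, so a minimizer with negative cost lies outside \<open>S\<close>.\<close>

lemma ascg_choice_new_column:
  assumes "ascg_choice V E y S \<epsilon> \<pi> s" "min_reduced_cost V E \<pi> < 0"
  shows "s \<in> MIS V E - S"
  using assms
  by (auto simp: ascg_choice_def grdp_optimal_def is_arg_max_def grdp_feasible_def reduced_cost_def)

lemma update_penalty_eq_0_iff: "update_penalty c = 0 \<longleftrightarrow> c \<ge> 0"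
  by (auto simp: update_penalty_def)

theorem lemma3p5:
  fixes V :: "'a set" and E :: "'a set set" and y :: "'a \<Rightarrow> real"
    and S\<^sub>0 :: "'a set set" and \<epsilon>\<^sub>0 :: real and N :: enat
    and S :: "nat \<Rightarrow> 'a set set" and \<epsilon> :: "nat \<Rightarrow> real"
    and \<pi> :: "nat \<Rightarrow> 'a \<Rightarrow> real" and s :: "nat \<Rightarrow> 'a set"
  assumes "finite_graph V E"
    and "\<And>S'. S' \<subseteq> MIS V E \<Longrightarrow> \<exists>x. grdp_feasible V S' y x"
    and "S\<^sub>0 \<subseteq> MIS V E"
    and "\<epsilon>\<^sub>0 \<ge> 0"
    and "ascg_run V E y S\<^sub>0 \<epsilon>\<^sub>0 N S \<epsilon> \<pi> s"
  shows "\<exists>k. enat k < N \<and> \<epsilon> (Suc k) = 0"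
proof (rule ccontr)
  assume "\<not> ?thesis"
  then have nz: "\<epsilon> (Suc k) \<noteq> 0" if "enat k < N" for k
    using that by blast
  have start: "S 0 = S\<^sub>0"
    and step: "\<And>k. enat k < N \<Longrightarrow> ascg_choice V E y (S k) (\<epsilon> k) (\<pi> k) (s k) \<and>
        S (Suc k) = S k \<union> {s k} \<and> \<epsilon> (Suc k) = update_penalty (min_reduced_cost V E (\<pi> k))"
    and final: "\<And>n. N = enat n \<Longrightarrow> (\<exists>k. n = Suc k \<and> ascg_stop V E (\<epsilon> k) (\<pi> k)) \<or>
        \<not> (\<exists>\<pi>' s'. ascg_choice V E y (S n) (\<epsilon> n) \<pi>' s')"
    using assms(5) unfolding ascg_run_def by blast+
  have neg: "min_reduced_cost V E (\<pi> k) < 0" if "enat k < N" for k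
    using nz[OF that] step[OF that] by (simp add: update_penalty_eq_0_iff)
  have new: "s k \<in> MIS V E - S k" if "enat k < N" for k
    using ascg_choice_new_column neg step that by blast
  \<comment> \<open>Each iteration adds exactly one new column. The case \<open>k = N\<close> is
    included because the column set after the last iteration is needed below.\<close>
  have grow: "S k \<subseteq> MIS V E \<and> k \<le> card (S k)" if "enat k \<le> N" for k
    using that
  proof (induction k)
    case 0
    then show ?case
      using assms(3) start by simp
  next
    case (Suc k)
    then have k: "enat k < N"
      by (simp add: Suc_ile_eq)
    then have IH: "S k \<subseteq> MIS V E" "k \<le> card (S k)"
      using Suc.IH by auto
    then have "finite (S k)"
      using finite_MIS[OF assms(1)] finite_subset by blast
    then show ?case
      using IH new[OF k] step[OF k] by auto
  qed
  have bound: "k \<le> card (MIS V E)" if "enat k \<le> N" for k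
    using grow[OF that] card_mono[OF finite_MIS[OF assms(1)]] le_trans by blast
  \<comment> \<open>An infinite \<open>N\<close> would allow \<open>k\<close> to exceed the number
    of maximal independent sets by one.\<close>
  obtain n where n: "N = enat n"
    using bound[of "Suc (card (MIS V E))"] by (cases N) auto
  \<comment> \<open>Another iteration is always possible, which leaves only the stopping test in
    \<open>final\<close>; this also excludes \<open>N = 0\<close>.\<close>
  have "\<exists>\<pi>' s'. ascg_choice V E y (S n) (\<epsilon> n) \<pi>' s'"
    using ascg_choice_exists[OF assms(1)] assms(2) grow[of n] n by simp
  then obtain k where "n = Suc k" "ascg_stop V E (\<epsilon> k) (\<pi> k)"
    using final[OF n] by blast
  then show False
    using neg[of k] n by (simp add: ascg_stop_def)
qed

end
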